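(* Let $G$ be a finite simple graph. Then $$|E(G)|\geq \alpha(G)-c(G)+\Gamma(\alpha(G),\tau(G)).$$
   Context: $\alpha(G)$ is the maximum cardinality of a stable (independent) set of $G$, $\tau(G)$ is the minimum cardinality of a vertex cover of $G$, and $c(G)$ is the number of connected components of $G$. For natural numbers $a,t$, $$\Gamma(a,t)=\min\left\{\sum_{i=1}^{a}\binom{z_i}{2} : z_1+\cdots+z_a=a+t,\ z_i\in\mathbb{Z},\ z_i\geq 0\ \forall i\right\}.$$ *)

theory Defs
  imports Complex_Main
begin

definition finite_simple_graph :: "'a set \<Rightarrow> 'a set set \<Rightarrow> bool" where
  "finite_simple_graph V E \<longleftrightarrow> finite V \<and> (\<forall>e\<in>E. e \<subseteq> V \<and> card e = 2)"

definition stable_set :: "'a set \<Rightarrow> 'a set set \<Rightarrow> 'a set \<Rightarrow> bool" where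
  "stable_set V E S \<longleftrightarrow> S \<subseteq> V \<and> (\<forall>u\<in>S. \<forall>v\<in>S. {u, v} \<notin> E)"

definition vertex_cover :: "'a set \<Rightarrow> 'a set set \<Rightarrow> 'a set \<Rightarrow> bool" where
  "vertex_cover V E C \<longleftrightarrow> C \<subseteq> V \<and> (\<forall>e\<in>E. e \<inter> C \<noteq> {})"

definition stability_number :: "'a set \<Rightarrow> 'a set set \<Rightarrow> nat" where
  "stability_number V E = Max (card ` {S. stable_set V E S})"

definition cover_number :: "'a set \<Rightarrow> 'a set set \<Rightarrow> nat" where
  "cover_number V E = Min (card ` {C. vertex_cover V E C})"

definition connected_rel :: "'a set \<Rightarrow> 'a set set \<Rightarrow> ('a \<times> 'a) set" where
  "connected_rel V E = {(u, v). u \<in> V \<and> v \<in> V \<and> (u, v) \<in> {(x, y). {x, y} \<in> E}\<^sup>*}"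

definition num_components :: "'a set \<Rightarrow> 'a set set \<Rightarrow> nat" where
  "num_components V E = card (V // connected_rel V E)"

(* The set below is empty only if a = 0 < t, a case that does not occur for a = alpha(G),
   t = tau(G); otherwise Inf on nat is the minimum. *)
definition Gamma_min :: "nat \<Rightarrow> nat \<Rightarrow> nat" where
  "Gamma_min a t = Inf {(\<Sum>i=1..a. z i choose 2) | z :: nat \<Rightarrow> nat. (\<Sum>i=1..a. z i) = a + t}"

end

theory Submission
  imports Defs
begin

text \<open>
  Induction on the number of vertices and edges. Deleting a non-critical edge keeps \<open>\<alpha>\<close> and
  \<open>\<tau>\<close> and creates at most one new component. If all edges are critical, delete the closed
  neighbourhood \<open>N\<close> of a vertex of minimum degree \<open>d\<close>, as in Turan's theorem: \<open>\<alpha>\<close> drops by one,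
  and \<open>\<Gamma>\<close> grows by at most \<open>d + 1 choose 2\<close> on the way back. A critical bridge has no critical
  neighbouring edge, so each component of \<open>G - N\<close> that is joined to \<open>N\<close> receives at least two
  of the edges leaving \<open>N\<close>. With \<open>m\<close> edges inside \<open>N\<close>, \<open>x\<close> edges leaving \<open>N\<close> and
  \<open>k\<close> such components, \<open>2 m + x \<ge> d (d + 1)\<close> and \<open>x \<ge> 2 k\<close> add up to
  \<open>m + x \<ge> (d + 1 choose 2) + k\<close>, which pays for the change of \<open>\<Gamma>\<close> and of the component count.
\<close>

section \<open>Stable sets and vertex covers\<close>

lemma finite_graphD:
  assumes "finite_simple_graph V E"
  shows "finite V" "finite E" "\<And>e. e \<in> E \<Longrightarrow> e \<subseteq> V" "\<And>e. e \<in> E \<Longrightarrow> card e = 2"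
    "\<And>x y. {x, y} \<in> E \<Longrightarrow> x \<noteq> y"
proof -
  show 1: "finite V" "\<And>e. e \<in> E \<Longrightarrow> e \<subseteq> V" "\<And>e. e \<in> E \<Longrightarrow> card e = 2"
    using assms by (auto simp: finite_simple_graph_def)
  then have "E \<subseteq> Pow V" by blast
  then show "finite E" using 1(1) by (meson finite_Pow_iff finite_subset)
  show "\<And>x y. {x, y} \<in> E \<Longrightarrow> x \<noteq> y" using 1(3) by fastforce
qed

lemma finite_stable_sets: "finite V \<Longrightarrow> finite {S. stable_set V E S}"
  by (rule finite_subset[of _ "Pow V"]) (auto simp: stable_set_def)

lemma card_stable_le:
  assumes "finite V" "stable_set V E S"
  shows "card S \<le> stability_number V E"
  unfolding stability_number_def using assms by (auto intro!: Max_ge finite_stable_sets)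

lemma obtain_max_stable:
  assumes "finite V"
  obtains S where "stable_set V E S" "card S = stability_number V E"
proof -
  have "stable_set V E {}" by (simp add: stable_set_def)
  then have "Max (card ` {S. stable_set V E S}) \<in> card ` {S. stable_set V E S}"
    using finite_stable_sets[OF assms] by (intro Max_in) auto
  then show ?thesis using that unfolding stability_number_def by auto
qed

lemma stable_complement_cover:
  assumes "finite_simple_graph V E" "S \<subseteq> V"
  shows "stable_set V E S \<longleftrightarrow> vertex_cover V E (V - S)"
proof
  assume st: "stable_set V E S"
  have "e \<inter> (V - S) \<noteq> {}" if "e \<in> E" for e
  proof
    assume "e \<inter> (V - S) = {}"
    then have "e \<subseteq> S" using finite_graphD(3)[OF assms(1) that] by blast
    moreover obtain x y where "e = {x, y}"
      using finite_graphD(4)[OF assms(1) \<open>e \<in> E\<close>] by (meson card_2_iff)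
    ultimately show False using st that by (auto simp: stable_set_def)
  qed
  then show "vertex_cover V E (V - S)" by (auto simp: vertex_cover_def)
next
  assume "vertex_cover V E (V - S)"
  then have "e \<inter> (V - S) \<noteq> {}" if "e \<in> E" for e using that by (simp add: vertex_cover_def)
  then have "{u, w} \<notin> E" if "u \<in> S" "w \<in> S" for u w using that by fastforce
  then show "stable_set V E S" using assms(2) by (simp add: stable_set_def)
qed

text \<open>Gallai's identity: complementation swaps stable sets and vertex covers, so the
  complement of a largest stable set is a smallest cover. It lets the induction follow \<tau>
  through \<alpha> and the number of vertices.\<close>

lemma stability_plus_cover:
  assumes "finite_simple_graph V E"
  shows "stability_number V E + cover_number V E = card V"
proof -
  have fV: "finite V" using finite_graphD(1)[OF assms] .
  let ?C = "{C. vertex_cover V E C}"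
  obtain S where S: "stable_set V E S" "card S = stability_number V E"
    using obtain_max_stable[OF fV] .
  have SV: "S \<subseteq> V" using S(1) by (simp add: stable_set_def)
  have "cover_number V E = card (V - S)"
    unfolding cover_number_def
  proof (rule Min_eqI)
    show "finite (card ` ?C)"
      by (rule finite_imageI, rule finite_subset[of _ "Pow V"]) (auto simp: vertex_cover_def fV)
    show "card (V - S) \<in> card ` ?C"
      using stable_complement_cover[OF assms SV] S(1) by blast
    fix k assume "k \<in> card ` ?C"
    then obtain C where C: "vertex_cover V E C" "k = card C" by blast
    then have CV: "C \<subseteq> V" by (simp add: vertex_cover_def)
    then have "stable_set V E (V - C)"
      using stable_complement_cover[OF assms, of "V - C"] C(1) by (simp add: double_diff)
    then have "card (V - C) \<le> card S" using card_stable_le[OF fV] S(2) by metis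
    then show "card (V - S) \<le> k" using C(2) CV SV fV
      by (simp add: card_Diff_subset finite_subset)
  qed
  then show ?thesis using S(2) SV fV
    by (metis card_Diff_subset card_mono finite_subset le_add_diff_inverse)
qed

lemma stability_number_pos:
  assumes "finite_simple_graph V E" "V \<noteq> {}"
  shows "stability_number V E > 0"
proof -
  obtain v where "v \<in> V" using assms(2) by blast
  then have "stable_set V E {v}"
    using finite_graphD(5)[OF assms(1), of v v] by (auto simp: stable_set_def)
  then show ?thesis using card_stable_le[OF finite_graphD(1)[OF assms(1)]] by fastforce
qed

section \<open>The function \<Gamma>\<close>

lemma Gamma_min_le:
  assumes "(\<Sum>i=1..a. z i) = a + t"
  shows "Gamma_min a t \<le> (\<Sum>i=1..a. z i choose 2)"
  unfolding Gamma_min_def by (rule cInf_lower) (use assms in auto)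

lemma obtain_Gamma_min:
  assumes "a = 0 \<Longrightarrow> t = 0"
  obtains z where "(\<Sum>i=1..a. z i) = a + t" "Gamma_min a t = (\<Sum>i=1..a. z i choose 2)"
proof -
  let ?A = "{(\<Sum>i=1..a. z i choose 2) | z :: nat \<Rightarrow> nat. (\<Sum>i=1..a. z i) = a + t}"
  \<comment> \<open>Putting the whole weight on the first part shows that the infimum is over a
    nonempty set. For \<open>a = 0\<close> the sum is empty, which is where the hypothesis
    \<open>t = 0\<close> enters.\<close>
  have "(\<Sum>i=1..a. (if i = 1 then a + t else 0)) = a + t"
    using assms by (cases a) (auto simp: sum.delta)
  then have "?A \<noteq> {}" by blast
  then have "Gamma_min a t \<in> ?A" unfolding Gamma_min_def by (rule Inf_nat_def1)
  then show ?thesis using that by blast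
qed

text \<open>An optimal distribution over \<open>a\<close> parts extends by one further part of size
  \<open>d\<close>. In the main induction this part has the size of the deleted closed
  neighbourhood.\<close>

lemma Gamma_min_Suc_le:
  assumes "a = 0 \<Longrightarrow> t = 0" "Suc a + s = d + (a + t)"
  shows "Gamma_min (Suc a) s \<le> Gamma_min a t + (d choose 2)"
proof -
  obtain z where z: "(\<Sum>i=1..a. z i) = a + t" "Gamma_min a t = (\<Sum>i=1..a. z i choose 2)"
    using obtain_Gamma_min assms(1) by metis
  let ?z = "z(Suc a := d)"
  have "(\<Sum>i=1..a. ?z i) = (\<Sum>i=1..a. z i)" "(\<Sum>i=1..a. ?z i choose 2) = (\<Sum>i=1..a. z i choose 2)"
    by (auto intro!: sum.cong)
  then show ?thesis using Gamma_min_le[of ?z "Suc a" s] z assms(2) by simp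
qed

section \<open>Connected components under deletion\<close>

lemma equiv_connected_rel: "equiv V (connected_rel V E)"
proof (rule equivI)
  show "connected_rel V E \<subseteq> V \<times> V" by (auto simp: connected_rel_def)
  show "refl_on V (connected_rel V E)" by (auto simp: refl_on_def connected_rel_def)
  have "sym {(x, y). {x, y} \<in> E}" by (auto simp: sym_def insert_commute)
  then have "sym ({(x, y). {x, y} \<in> E}\<^sup>*)" by (rule sym_rtrancl)
  then show "sym (connected_rel V E)" unfolding connected_rel_def sym_def by blast
  show "trans (connected_rel V E)" unfolding connected_rel_def trans_def
    by (auto intro: rtrancl_trans)
qed

lemma finite_components: "finite V \<Longrightarrow> finite (V // connected_rel V E)"
  by (simp add: quotient_def)

lemma component_eq_class:
  assumes "C \<in> V // connected_rel V E" "x \<in> C"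
  shows "C = connected_rel V E `` {x}"
  using assms(1)
proof (rule quotientE)
  fix a assume "C = connected_rel V E `` {a}"
  then show ?thesis using assms(2) equiv_class_eq[OF equiv_connected_rel] by fastforce
qed

lemma component_closed:
  assumes "finite_simple_graph V E" "C \<in> V // connected_rel V E" "b \<in> C" "{b, c} \<in> E"
  shows "c \<in> C"
proof -
  obtain a where a: "C = connected_rel V E `` {a}" using assms(2) by (rule quotientE)
  have "c \<in> V" using finite_graphD(3)[OF assms(1,4)] by blast
  then show ?thesis using assms(3,4) a
    by (auto simp: connected_rel_def intro: rtrancl_into_rtrancl)
qed

text \<open>By the last hypothesis, a walk of the larger graph that starts in \<open>C\<close> uses
  only edges of \<open>E'\<close> and so never leaves \<open>C\<close>. Both deletion steps
  recognise untouched components in this way.\<close>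

lemma component_of_subgraph:
  assumes H: "finite_simple_graph V' E'" and "V' \<subseteq> V" "E' \<subseteq> E"
    and C: "C \<in> V' // connected_rel V' E'"
    and out: "\<And>e. e \<in> E \<Longrightarrow> e \<inter> C \<noteq> {} \<Longrightarrow> e \<in> E'"
  shows "C \<in> V // connected_rel V E"
proof -
  obtain a where a: "C = connected_rel V' E' `` {a}" "a \<in> V'" using C by (rule quotientE)
  have "b \<in> C" if "(a, b) \<in> {(x, y). {x, y} \<in> E}\<^sup>*" for b
    using that
  proof induction
    case base
    show ?case using a by (simp add: connected_rel_def)
  next
    case (step b c)
    then have "{b, c} \<in> E'" using out by blast
    then show ?case using component_closed[OF H C step.IH] by blast
  qed
  then have "connected_rel V E `` {a} \<subseteq> C" by (auto simp: connected_rel_def)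
  moreover have "{(x, y). {x, y} \<in> E'}\<^sup>* \<subseteq> {(x, y). {x, y} \<in> E}\<^sup>*"
    using \<open>E' \<subseteq> E\<close> by (intro rtrancl_mono) auto
  then have "C \<subseteq> connected_rel V E `` {a}"
    using a \<open>V' \<subseteq> V\<close> by (auto simp: connected_rel_def)
  ultimately show ?thesis using a \<open>V' \<subseteq> V\<close> by (metis quotientI subsetD subset_antisym)
qed

lemma num_components_delete_edge:
  assumes G: "finite_simple_graph V E" and e: "e \<in> E"
  shows "num_components V (E - {e}) \<le> num_components V E + 1"
proof -
  obtain x y where xy: "e = {x, y}" using finite_graphD(4)[OF G e] by (meson card_2_iff)
  have fV: "finite V" and x: "x \<in> V" and y: "y \<in> V"
    using finite_graphD(1,3)[OF G] e xy by blast+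
  have G': "finite_simple_graph V (E - {e})" using G by (simp add: finite_simple_graph_def)
  let ?R = "connected_rel V E" and ?R' = "connected_rel V (E - {e})"
  \<comment> \<open>A component of the smaller graph that avoids both ends of \<open>e\<close>
    survives unchanged in \<open>G\<close>, and it is not the component of \<open>x\<close>. Thus at
    most two classes replace the one that contains \<open>e\<close>.\<close>
  have "V // ?R' - {?R' `` {x}, ?R' `` {y}} \<subseteq> V // ?R - {?R `` {x}}"
  proof
    fix C assume C: "C \<in> V // ?R' - {?R' `` {x}, ?R' `` {y}}"
    then have CR: "C \<in> V // ?R'" and ne: "C \<noteq> ?R' `` {x}" "C \<noteq> ?R' `` {y}" by simp_all
    have nin: "x \<notin> C" "y \<notin> C"
      using component_eq_class[OF CR] ne by metis+
    have "C \<in> V // ?R"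
      by (rule component_of_subgraph[OF G']) (use CR nin xy in auto)
    moreover have "C \<noteq> ?R `` {x}" using nin(1) x equiv_class_self[OF equiv_connected_rel] by metis
    ultimately show "C \<in> V // ?R - {?R `` {x}}" by blast
  qed
  then have "card (V // ?R' - {?R' `` {x}, ?R' `` {y}}) \<le> card (V // ?R - {?R `` {x}})"
    by (intro card_mono) (auto intro: finite_components fV)
  also have "\<dots> = card (V // ?R) - 1"
    using x by (intro card_Diff_singleton) (auto intro: quotientI)
  finally have "card (V // ?R' - {?R' `` {x}, ?R' `` {y}}) \<le> card (V // ?R) - 1" .
  moreover have "card (V // ?R') - card {?R' `` {x}, ?R' `` {y}} \<le> card (V // ?R' - {?R' `` {x}, ?R' `` {y}})"
    by (rule diff_card_le_card_Diff) simp
  moreover have "card {?R' `` {x}, ?R' `` {y}} \<le> 2" by (simp add: card_insert_if)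
  moreover have "card (V // ?R) > 0"
    using x by (auto simp: card_gt_0_iff quotient_def fV)
  ultimately show ?thesis unfolding num_components_def by linarith
qed

section \<open>Critical edges\<close>

definition critical_edge :: "'a set \<Rightarrow> 'a set set \<Rightarrow> 'a set \<Rightarrow> bool" where
  "critical_edge V E e \<longleftrightarrow> stability_number V E < stability_number V (E - {e})"

text \<open>A stable set of the graph without the edge that misses one of its ends is already stable
  in the full graph, hence not too large.\<close>

lemma critical_edgeE:
  assumes "finite V" "critical_edge V E {x, y}"
  obtains S where "stable_set V (E - {{x, y}}) S" "card S > stability_number V E" "x \<in> S" "y \<in> S"
proof -
  obtain S where S: "stable_set V (E - {{x, y}}) S" "card S > stability_number V E"
    using assms obtain_max_stable[OF assms(1)] unfolding critical_edge_def by metis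
  have "x \<in> S \<and> y \<in> S"
  proof (rule ccontr)
    assume "\<not> (x \<in> S \<and> y \<in> S)"
    then have "stable_set V E S" using S(1) unfolding stable_set_def
      by (metis Diff_iff doubleton_eq_iff singletonD)
    then show False using card_stable_le[OF assms(1)] S(2) by (metis not_less)
  qed
  then show ?thesis using that S by blast
qed

text \<open>Two stable sets witnessing criticality of the bridge and of an adjacent edge can be
  recombined along the cut into two stable sets that are too large in total.\<close>

lemma critical_bridge_isolated:
  assumes G: "finite_simple_graph V E" and xy: "{x, y} \<in> E" and xz: "{x, z} \<in> E"
    and x: "x \<notin> B" and z: "z \<notin> B" and y: "y \<in> B"
    and bridge: "\<And>u w. {u, w} \<in> E \<Longrightarrow> u \<notin> B \<Longrightarrow> w \<in> B \<Longrightarrow> u = x \<and> w = y"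
    and crit: "critical_edge V E {x, y}" "critical_edge V E {x, z}"
  shows False
proof -
  have fV: "finite V" using finite_graphD(1)[OF G] .
  obtain S where S: "stable_set V (E - {{x, y}}) S" "card S > stability_number V E"
      "x \<in> S" "y \<in> S" using critical_edgeE[OF fV crit(1)] .
  obtain T where T: "stable_set V (E - {{x, z}}) T" "card T > stability_number V E"
      "x \<in> T" "z \<in> T" using critical_edgeE[OF fV crit(2)] .
  have fin: "finite S" "finite T" using S(1) T(1) fV by (auto simp: stable_set_def intro: finite_subset)
  have adjS: "\<And>u w. u \<in> S \<Longrightarrow> w \<in> S \<Longrightarrow> {u, w} \<in> E \<Longrightarrow> {u, w} = {x, y}"
    and adjT: "\<And>u w. u \<in> T \<Longrightarrow> w \<in> T \<Longrightarrow> {u, w} \<in> E \<Longrightarrow> {u, w} = {x, z}"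
    using S(1) T(1) by (auto simp: stable_set_def)
  have sub: "S \<subseteq> V" "T \<subseteq> V" using S(1) T(1) by (auto simp: stable_set_def)
  \<comment> \<open>The only edge inside \<open>T\<close> is \<open>{x, z}\<close>, and
    \<open>z\<close> differs from \<open>y\<close> because \<open>B\<close> separates them.\<close>
  have yT: "y \<notin> T" using adjT[OF T(3) _ xy] y z finite_graphD(5)[OF G xy] by (auto simp: doubleton_eq_iff)
  have bridge': "\<And>u w. {u, w} \<in> E \<Longrightarrow> w \<notin> B \<Longrightarrow> u \<in> B \<Longrightarrow> w = x \<and> u = y"
    using bridge by (metis insert_commute)
  \<comment> \<open>Each half loses the one edge its source may contain: \<open>y\<close> is missing
    from \<open>S - B\<close>, and \<open>x\<close> from \<open>T \<inter> B\<close>. The bridge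
    cannot join the halves since \<open>y\<close> is not in \<open>T\<close>.\<close>
  have "stable_set V E ((S - B) \<union> (T \<inter> B))"
    unfolding stable_set_def
  proof (intro conjI ballI notI)
    fix u w assume u: "u \<in> (S - B) \<union> (T \<inter> B)" and w: "w \<in> (S - B) \<union> (T \<inter> B)" and E: "{u, w} \<in> E"
    show False
      using u w adjS[OF _ _ E] adjT[OF _ _ E] bridge[OF E] bridge'[OF E] yT x y z
      by (auto simp: doubleton_eq_iff)
  qed (use sub in auto)
  then have 1: "card ((S - B) \<union> (T \<inter> B)) \<le> stability_number V E" by (rule card_stable_le[OF fV])
  \<comment> \<open>Removing \<open>x\<close> destroys both the edge \<open>{x, z}\<close> inside
    \<open>T\<close> and the bridge to \<open>y\<close> in \<open>S\<close>.\<close>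
  have "stable_set V E (((T - B) - {x}) \<union> (S \<inter> B))"
    unfolding stable_set_def
  proof (intro conjI ballI notI)
    fix u w assume u: "u \<in> ((T - B) - {x}) \<union> (S \<inter> B)" and w: "w \<in> ((T - B) - {x}) \<union> (S \<inter> B)"
      and E: "{u, w} \<in> E"
    show False
      using u w adjS[OF _ _ E] adjT[OF _ _ E] bridge[OF E] bridge'[OF E] x y z
      by (auto simp: doubleton_eq_iff)
  qed (use sub in auto)
  then have 2: "card (((T - B) - {x}) \<union> (S \<inter> B)) \<le> stability_number V E" by (rule card_stable_le[OF fV])
  have "card ((S - B) \<union> (T \<inter> B)) = card (S - B) + card (T \<inter> B)"
    using fin by (intro card_Un_disjoint) auto
  moreover have "card (((T - B) - {x}) \<union> (S \<inter> B)) = card ((T - B) - {x}) + card (S \<inter> B)"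
    using fin by (intro card_Un_disjoint) auto
  moreover have "card ((T - B) - {x}) = card (T - B) - 1" using T(3) x by simp
  moreover have "card S = card (S - B) + card (S \<inter> B)" "card T = card (T - B) + card (T \<inter> B)"
    using card_Int_Diff[OF fin(1), of B] card_Int_Diff[OF fin(2), of B] by simp_all
  \<comment> \<open>The two new sets have \<open>card S + card T - 1\<close> elements in total, at
    least 2\<alpha> + 1, whereas each has at most \<alpha>.\<close>
  ultimately show False using 1 2 S(2) T(2) by linarith
qed

section \<open>Degrees and closed neighbourhoods\<close>

text \<open>Counting incident edges instead of neighbours suits the double counting in
  \<open>sum_degree\<close>; \<open>card_closed_nbhd\<close> translates to neighbours.\<close>

definition degree :: "'a set set \<Rightarrow> 'a \<Rightarrow> nat" where
  "degree E v = card {e \<in> E. v \<in> e}"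

definition closed_nbhd :: "'a set set \<Rightarrow> 'a \<Rightarrow> 'a set" where
  "closed_nbhd E v = insert v {u. {v, u} \<in> E}"

lemma card_closed_nbhd:
  assumes G: "finite_simple_graph V E"
  shows "card (closed_nbhd E v) = Suc (degree E v)"
proof -
  have "bij_betw (\<lambda>u. {v, u}) {u. {v, u} \<in> E} {e \<in> E. v \<in> e}"
    unfolding bij_betw_def
  proof
    show "inj_on (\<lambda>u. {v, u}) {u. {v, u} \<in> E}" by (auto simp: inj_on_def doubleton_eq_iff)
    have "\<exists>u. e = {v, u}" if "e \<in> E" "v \<in> e" for e
    proof -
      obtain a b where "e = {a, b}" using finite_graphD(4)[OF G \<open>e \<in> E\<close>] by (meson card_2_iff)
      then show ?thesis using \<open>v \<in> e\<close> by auto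
    qed
    then show "(\<lambda>u. {v, u}) ` {u. {v, u} \<in> E} = {e \<in> E. v \<in> e}" by auto
  qed
  then have "card {u. {v, u} \<in> E} = degree E v" unfolding degree_def by (rule bij_betw_same_card)
  moreover have "v \<notin> {u. {v, u} \<in> E}" using finite_graphD(5)[OF G, of v v] by blast
  moreover have "finite {u. {v, u} \<in> E}"
    using finite_graphD(1,3)[OF G] by (rule_tac finite_subset[of _ V]) auto
  ultimately show ?thesis unfolding closed_nbhd_def by simp
qed

text \<open>Double counting of incidences: an edge contributes its number of ends in
  \<open>N\<close>, which is two, one or none.\<close>

lemma sum_degree:
  assumes G: "finite_simple_graph V E" and N: "finite N"
  shows "(\<Sum>u\<in>N. degree E u) = 2 * card {e \<in> E. e \<subseteq> N} + card {e \<in> E. e \<inter> N \<noteq> {} \<and> \<not> e \<subseteq> N}"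
proof -
  have fE: "finite E" using finite_graphD(2)[OF G] .
  have "(\<Sum>u\<in>N. degree E u) = (\<Sum>u\<in>N. \<Sum>e\<in>E. if u \<in> e then 1 else 0)"
    unfolding degree_def using fE by (simp add: sum.If_cases Int_def)
  also have "\<dots> = (\<Sum>e\<in>E. \<Sum>u\<in>N. if u \<in> e then 1 else 0)" by (rule sum.swap)
  also have "\<dots> = (\<Sum>e\<in>E. card (N \<inter> e))" using N by (simp add: sum.If_cases Int_def)
  also have "\<dots> = (\<Sum>e\<in>E. (if e \<subseteq> N then 2 else 0) + (if e \<inter> N \<noteq> {} \<and> \<not> e \<subseteq> N then 1 else 0))"
  proof (rule sum.cong[OF refl])
    fix e assume "e \<in> E"
    then obtain a b where "e = {a, b}" "a \<noteq> b"
      using finite_graphD(4)[OF G] by (meson card_2_iff)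
    then show "card (N \<inter> e) = (if e \<subseteq> N then 2 else 0) + (if e \<inter> N \<noteq> {} \<and> \<not> e \<subseteq> N then 1 else 0)"
      by (auto simp: Int_insert_right)
  qed
  also have "\<dots> = 2 * card {e \<in> E. e \<subseteq> N} + card {e \<in> E. e \<inter> N \<noteq> {} \<and> \<not> e \<subseteq> N}"
    using fE by (simp add: sum.distrib sum.If_cases Int_def)
  finally show ?thesis .
qed

section \<open>Deleting a closed neighbourhood\<close>

lemma stability_number_delete_nbhd:
  assumes G: "finite_simple_graph V E" and v: "v \<in> V"
    and crit: "\<And>e. e \<in> E \<Longrightarrow> critical_edge V E e"
  defines "W \<equiv> V - closed_nbhd E v"
  shows "stability_number V E = Suc (stability_number W {e \<in> E. e \<subseteq> W})"
proof (rule antisym)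
  have fV: "finite V" using finite_graphD(1)[OF G] .
  then have fW: "finite W" by (simp add: W_def)
  obtain S where S: "stable_set W {e \<in> E. e \<subseteq> W} S" "card S = stability_number W {e \<in> E. e \<subseteq> W}"
    using obtain_max_stable[OF fW] .
  have SW: "S \<subseteq> W" using S(1) by (simp add: stable_set_def)
  then have "finite S" "v \<notin> S" using fW by (auto simp: W_def closed_nbhd_def intro: finite_subset)
  moreover have "stable_set V E (insert v S)"
    unfolding stable_set_def
  proof (intro conjI ballI notI)
    fix u w assume uw: "u \<in> insert v S" "w \<in> insert v S" "{u, w} \<in> E"
    have nbr: "{v, u} \<notin> E" if "u \<in> S" for u
      using that SW by (auto simp: W_def closed_nbhd_def)
    then have "u \<in> S" "w \<in> S"
      using uw finite_graphD(5)[OF G uw(3)] nbr by (metis insertE insert_commute)+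
    then show False using S(1) SW uw(3) by (auto simp: stable_set_def)
  qed (use SW v in \<open>auto simp: W_def\<close>)
  ultimately show "Suc (stability_number W {e \<in> E. e \<subseteq> W}) \<le> stability_number V E"
    using card_stable_le[OF fV, of E "insert v S"] S(2) by simp
  \<comment> \<open>If \<open>v\<close> has a neighbour \<open>u\<close>, criticality of
    \<open>{v, u}\<close> yields a set of size at least \<alpha> + 1 whose only edge is
    \<open>{v, u}\<close>; it contains no other neighbour of \<open>v\<close>, so dropping
    \<open>v\<close> and \<open>u\<close> leaves a stable set in \<open>W\<close>. If
    \<open>v\<close> is isolated, dropping \<open>v\<close> from a maximum stable set
    suffices.\<close>
  have "\<exists>S. stable_set W {e \<in> E. e \<subseteq> W} S \<and> stability_number V E \<le> Suc (card S)"
  proof (cases "\<exists>u. {v, u} \<in> E")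
    case True
    then obtain u where u: "{v, u} \<in> E" by blast
    obtain S where S: "stable_set V (E - {{v, u}}) S" "card S > stability_number V E"
      "v \<in> S" "u \<in> S" using critical_edgeE[OF fV crit[OF u]] .
    have "finite S" using S(1) fV by (auto simp: stable_set_def intro: finite_subset)
    moreover have "u \<noteq> v" using finite_graphD(5)[OF G u] by simp
    ultimately have "card S = Suc (Suc (card (S - {v} - {u})))"
      using S(3,4) by (metis card_Suc_Diff1 finite_Diff insertE insert_Diff)
    moreover have "stable_set W {e \<in> E. e \<subseteq> W} (S - {v} - {u})"
      using S(1,3) unfolding stable_set_def W_def closed_nbhd_def
      by (auto simp: doubleton_eq_iff)
    ultimately show ?thesis using S(2) by (metis less_Suc_eq_le)
  next
    case False
    obtain S where S: "stable_set V E S" "card S = stability_number V E"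
      using obtain_max_stable[OF fV] .
    have "stable_set W {e \<in> E. e \<subseteq> W} (S - {v})"
      using S(1) False unfolding stable_set_def W_def closed_nbhd_def by auto
    moreover have "card S \<le> Suc (card (S - {v}))" by (cases "v \<in> S") auto
    ultimately show ?thesis using S(2) by metis
  qed
  then show "stability_number V E \<le> Suc (stability_number W {e \<in> E. e \<subseteq> W})"
    using card_stable_le[OF fW] by (meson Suc_le_mono le_trans)
qed

text \<open>Counts are doubled to avoid halves. Components of the rest not joined to
  \<open>N\<close> are components of \<open>G\<close> other than that of \<open>v\<close>, which
  accounts for the summand 2 on the left; each of the others is paid for by two edges leaving
  \<open>N\<close>.\<close>

lemma num_components_delete_nbhd:
  assumes G: "finite_simple_graph V E" and v: "v \<in> V"
    and crit: "\<And>e. e \<in> E \<Longrightarrow> critical_edge V E e"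
  defines "N \<equiv> closed_nbhd E v"
  defines "W \<equiv> V - N"
  shows "2 * num_components W {e \<in> E. e \<subseteq> W} + 2
    \<le> 2 * num_components V E + card {e \<in> E. e \<inter> N \<noteq> {} \<and> \<not> e \<subseteq> N}"
proof -
  let ?F = "{e \<in> E. e \<subseteq> W}" and ?X = "{e \<in> E. e \<inter> N \<noteq> {} \<and> \<not> e \<subseteq> N}"
  let ?D = "W // connected_rel W ?F" and ?X' = "\<lambda>C. {e \<in> E. e \<inter> N \<noteq> {} \<and> e \<inter> C \<noteq> {}}"
  have fV: "finite V" and fE: "finite E" using finite_graphD(1,2)[OF G] by blast+
  have vN: "v \<in> N" by (simp add: N_def closed_nbhd_def)
  have H: "finite_simple_graph W ?F"
    using G by (auto simp: finite_simple_graph_def W_def)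
  have fD: "finite ?D" using fV by (intro finite_components) (simp add: W_def)
  have DW: "C \<subseteq> W" if "C \<in> ?D" for C
    using that in_quotient_imp_subset[OF equiv_connected_rel] by blast
  \<comment> \<open>\<open>D0\<close> collects the components without an edge to \<open>N\<close>,
    \<open>D1\<close> those joined to \<open>N\<close>.\<close>
  define D0 where "D0 = {C \<in> ?D. ?X' C = {}}"
  define D1 where "D1 = {C \<in> ?D. ?X' C \<noteq> {}}"
  have D0: "D0 \<subseteq> V // connected_rel V E - {connected_rel V E `` {v}}"
  proof
    fix C assume C: "C \<in> D0"
    then have CD: "C \<in> ?D" by (simp add: D0_def)
    have inF: "e \<in> ?F" if "e \<in> E" "e \<inter> C \<noteq> {}" for e
    proof -
      have "?X' C = {}" using C by (simp add: D0_def)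
      then have "e \<inter> N = {}" using that by blast
      then show ?thesis using that(1) finite_graphD(3)[OF G that(1)] by (auto simp: W_def)
    qed
    have "C \<in> V // connected_rel V E"
      by (rule component_of_subgraph[OF H _ _ CD inF]) (auto simp: W_def)
    moreover have "v \<notin> C" using DW[OF CD] vN by (auto simp: W_def)
    then have "C \<noteq> connected_rel V E `` {v}"
      using equiv_class_self[OF equiv_connected_rel v] by blast
    ultimately show "C \<in> V // connected_rel V E - {connected_rel V E `` {v}}" by blast
  qed
  have "Suc (card D0) \<le> num_components V E"
  proof -
    have "card D0 \<le> card (V // connected_rel V E - {connected_rel V E `` {v}})"
      using D0 by (intro card_mono) (auto intro: finite_components fV)
    also have "\<dots> < card (V // connected_rel V E)"
      using v by (intro card_Diff1_less finite_components fV quotientI)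
    finally show ?thesis by (simp add: num_components_def)
  qed
  moreover have "2 * card D1 \<le> card ?X"
  proof -
    \<comment> \<open>A single edge \<open>{x, y}\<close> between \<open>N\<close> and
      \<open>C\<close> would be a bridge with \<open>C\<close> on one side. Its end \<open>x\<close>
      is not \<open>v\<close>, as \<open>y\<close> lies outside \<open>N\<close>, so
      \<open>{x, v}\<close> is a critical edge next to a critical bridge.\<close>
    have two: "2 \<le> card (?X' C)" if C: "C \<in> D1" for C
    proof (rule ccontr)
      assume "\<not> 2 \<le> card (?X' C)"
      moreover have "?X' C \<noteq> {}" and CD: "C \<in> ?D" using C by (auto simp: D1_def)
      moreover from this have "card (?X' C) > 0" using fE by (subst card_gt_0_iff) auto
      ultimately have "card (?X' C) = 1" by linarith
      then obtain e where e: "?X' C = {e}" by (meson card_1_singletonE)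
      then have eX: "e \<in> E" "e \<inter> N \<noteq> {}" "e \<inter> C \<noteq> {}" by blast+
      obtain x y where xy: "x \<in> N" "y \<in> C" "x \<in> e" "y \<in> e" using eX by blast
      have CN: "C \<inter> N = {}" using DW[OF CD] by (auto simp: W_def)
      then have "x \<noteq> y" using xy by blast
      then have exy: "e = {x, y}"
        using finite_graphD(4)[OF G eX(1)] xy by (auto simp: card_2_iff)
      have yv: "y \<notin> N" using CN xy by blast
      have "x \<noteq> v"
        using yv eX(1) exy by (auto simp: N_def closed_nbhd_def)
      then have xv: "{x, v} \<in> E" using xy(1) by (auto simp: N_def closed_nbhd_def insert_commute)
      show False
      proof (rule critical_bridge_isolated[OF G _ xv])
        show "{x, y} \<in> E" using eX(1) exy by simp
        then show "critical_edge V E {x, y}" by (rule crit)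
        show "critical_edge V E {x, v}" using xv by (rule crit)
        show "x \<notin> C" "v \<notin> C" using CN xy(1) vN by auto
        show "y \<in> C" by (rule xy(2))
        fix u w assume uw: "{u, w} \<in> E" "u \<notin> C" "w \<in> C"
        \<comment> \<open>An edge that enters \<open>C\<close> from outside \<open>N\<close> lies in
          the remaining graph, so both its ends are in the component \<open>C\<close>.\<close>
        have "u \<in> N"
        proof (rule ccontr)
          assume "u \<notin> N"
          then have "{w, u} \<in> ?F"
            using uw DW[OF CD] finite_graphD(3)[OF G uw(1)] by (auto simp: W_def insert_commute)
          then show False using component_closed[OF H CD uw(3)] uw(2) by blast
        qed
        then have "{u, w} \<in> ?X' C" using uw by auto
        then have "{u, w} = {x, y}" using e exy by auto
        then show "u = x \<and> w = y" using uw(2,3) xy(2) by (auto simp: doubleton_eq_iff)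
      qed
    qed
    \<comment> \<open>An edge counted for two components would have three distinct ends.\<close>
    have disj: "?X' C \<inter> ?X' C' = {}" if "C \<in> D1" "C' \<in> D1" "C \<noteq> C'" for C C'
    proof (rule ccontr)
      assume "?X' C \<inter> ?X' C' \<noteq> {}"
      then obtain e x y z where e: "e \<in> E" "x \<in> e" "y \<in> e" "z \<in> e" "x \<in> N" "y \<in> C" "z \<in> C'" by blast
      have CD: "C \<in> ?D" "C' \<in> ?D" using that by (auto simp: D1_def)
      then have "C \<inter> C' = {}" using quotient_disj[OF equiv_connected_rel] that(3) by blast
      moreover have "x \<notin> C" "x \<notin> C'" using DW CD e(5) by (auto simp: W_def)
      ultimately have "x \<noteq> y" "x \<noteq> z" "y \<noteq> z" using e(6,7) by blast+
      then have "card {x, y, z} = 3" by simp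
      moreover have "card {x, y, z} \<le> card e"
        using e finite_graphD(4)[OF G e(1)] by (intro card_mono) (auto intro: card_ge_0_finite)
      ultimately show False using finite_graphD(4)[OF G e(1)] by simp
    qed
    have "2 * card D1 = (\<Sum>C\<in>D1. 2)" by simp
    also have "\<dots> \<le> (\<Sum>C\<in>D1. card (?X' C))" using two by (rule sum_mono)
    also have "\<dots> = card (\<Union>C\<in>D1. ?X' C)"
      using fD fE disj by (intro card_UN_disjoint[symmetric]) (auto simp: D1_def)
    also have "\<dots> \<le> card ?X"
    proof (rule card_mono)
      show "(\<Union>C\<in>D1. ?X' C) \<subseteq> ?X" using DW unfolding D1_def W_def by blast
    qed (use fE in simp)
    finally show ?thesis .
  qed
  moreover have "num_components W ?F = card D0 + card D1"
  proof -
    have "?D = D0 \<union> D1" by (auto simp: D0_def D1_def)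
    moreover have "card (D0 \<union> D1) = card D0 + card D1"
      using fD by (intro card_Un_disjoint) (auto simp: D0_def D1_def)
    ultimately show ?thesis by (simp add: num_components_def)
  qed
  ultimately show ?thesis by simp
qed

section \<open>The induction\<close>

theorem theorem3p2:
  fixes V :: "'a set" and E :: "'a set set"
  assumes "finite_simple_graph V E"
  shows "int (card E) \<ge> int (stability_number V E) - int (num_components V E)
           + int (Gamma_min (stability_number V E) (cover_number V E))"
  using assms
proof (induction "card V + card E" arbitrary: V E rule: less_induct)
  case less
  note G = less.prems
  have fV: "finite V" and fE: "finite E" using finite_graphD(1,2)[OF G] by blast+
  note n = stability_plus_cover[OF G]
  consider "V = {}" | e where "e \<in> E" "\<not> critical_edge V E e"
    | "V \<noteq> {}" "\<And>e. e \<in> E \<Longrightarrow> critical_edge V E e" by blast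
  then show ?case
  proof cases
    case 1
    then have "stability_number V E = 0" "cover_number V E = 0" using n by auto
    then show ?thesis using Gamma_min_le[of "\<lambda>_. 0" 0 0] by simp
  next
    case (2 e)
    let ?E = "E - {e}"
    have G': "finite_simple_graph V ?E" using G by (simp add: finite_simple_graph_def)
    have cE: "card E = Suc (card ?E)" using fE 2(1) by (rule card.remove)
    obtain S where S: "stable_set V E S" "card S = stability_number V E"
      using obtain_max_stable[OF fV] .
    then have "stable_set V ?E S" by (auto simp: stable_set_def)
    then have "stability_number V E \<le> stability_number V ?E" using card_stable_le[OF fV] S(2) by metis
    then have a: "stability_number V ?E = stability_number V E"
      using 2(2) by (simp add: critical_edge_def)
    then have "cover_number V ?E = cover_number V E"
      using n stability_plus_cover[OF G'] by linarith
    \<comment> \<open>Restoring the edge adds one to the edge count and lowers the component count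
      by at most one; the other terms agree.\<close>
    then show ?thesis
      using less.hyps[OF _ G'] a cE num_components_delete_edge[OF G 2(1)] by simp
  next
    case 3
    define v where "v = arg_min_on (degree E) V"
    have v: "v \<in> V" using arg_min_if_finite(1)[OF fV 3(1)] by (simp add: v_def)
    have vmin: "degree E v \<le> degree E u" if "u \<in> V" for u
      using arg_min_least[OF fV 3(1) that] by (simp add: v_def)
    define d where "d = degree E v"
    define N where "N = closed_nbhd E v"
    define W where "W = V - N"
    let ?F = "{e \<in> E. e \<subseteq> W}" and ?M = "{e \<in> E. e \<subseteq> N}"
      and ?X = "{e \<in> E. e \<inter> N \<noteq> {} \<and> \<not> e \<subseteq> N}"
    have NV: "N \<subseteq> V" using v finite_graphD(3)[OF G] by (auto simp: N_def closed_nbhd_def)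
    have fN: "finite N" using NV fV by (rule finite_subset)
    have cN: "card N = Suc d" using card_closed_nbhd[OF G] by (simp add: N_def d_def)
    have H: "finite_simple_graph W ?F" using G by (auto simp: finite_simple_graph_def W_def)
    have cW: "card V = Suc d + card W" using NV fN fV cN
      by (metis W_def card_Diff_subset card_mono le_add_diff_inverse)
    have cE: "card E = card ?F + card ?M + card ?X"
    proof -
      have "E = ?F \<union> ?M \<union> ?X" using finite_graphD(3)[OF G] by (auto simp: W_def)
      then have "card E = card (?F \<union> ?M \<union> ?X)" by simp
      also have "\<dots> = card (?F \<union> ?M) + card ?X"
        using fE by (intro card_Un_disjoint) (auto simp: W_def)
      also have "card (?F \<union> ?M) = card ?F + card ?M"
      proof (rule card_Un_disjoint)
        have "e \<notin> ?M" if "e \<in> ?F" for e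
        proof
          assume "e \<in> ?M"
          then have "e = {}" using that by (auto simp: W_def)
          then show False using finite_graphD(4)[OF G, of e] that by simp
        qed
        then show "?F \<inter> ?M = {}" by blast
      qed (use fE in auto)
      finally show ?thesis .
    qed
    have a: "stability_number V E = Suc (stability_number W ?F)"
      using stability_number_delete_nbhd[OF G v 3(2)] by (simp add: W_def N_def)
    have c: "2 * num_components W ?F + 2 \<le> 2 * num_components V E + card ?X"
      using num_components_delete_nbhd[OF G v 3(2)] by (simp add: W_def N_def)
    \<comment> \<open>By minimality of \<open>d\<close>, each of the \<open>d + 1\<close> vertices
      of \<open>N\<close> has degree at least \<open>d\<close>.\<close>
    have "Suc d * d = (\<Sum>u\<in>N. d)" using cN by simp
    also have "\<dots> \<le> (\<Sum>u\<in>N. degree E u)"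
      using vmin NV unfolding d_def by (intro sum_mono) auto
    also have "\<dots> = 2 * card ?M + card ?X" by (rule sum_degree[OF G fN])
    finally have "2 * (Suc d choose 2) \<le> 2 * card ?M + card ?X"
      by (simp add: choose_two)
    moreover have "Gamma_min (stability_number V E) (cover_number V E)
        \<le> Gamma_min (stability_number W ?F) (cover_number W ?F) + (Suc d choose 2)"
      unfolding a
    proof (rule Gamma_min_Suc_le)
      assume "stability_number W ?F = 0"
      then have "W = {}" using stability_number_pos[OF H] by auto
      then show "cover_number W ?F = 0" using stability_plus_cover[OF H] by simp
    next
      \<comment> \<open>Both sides equal \<open>card V\<close>, by Gallai's identity for the graph
        and for the rest on \<open>W\<close>.\<close>
      show "Suc (stability_number W ?F) + cover_number V E
          = Suc d + (stability_number W ?F + cover_number W ?F)"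
        using n a cW stability_plus_cover[OF H] by simp
    qed
    moreover have "int (card ?F) \<ge> int (stability_number W ?F) - int (num_components W ?F)
        + int (Gamma_min (stability_number W ?F) (cover_number W ?F))"
    proof (rule less.hyps[OF _ H])
      have "card ?F \<le> card E" using fE by (intro card_mono) auto
      then show "card W + card ?F < card V + card E" using cW by linarith
    qed
    \<comment> \<open>Half of the edges in \<open>?X\<close> pay for the extra components; the other
      half together with \<open>?M\<close> pay for \<open>Suc d choose 2\<close>.\<close>
    ultimately show ?thesis using a c cE by linarith
  qed
qed

end
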